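(* For all $n\ge1$, the partial order $\Omega_n$ is a pre-shelling of the order complex $\Delta(J(\mathbf{2}\times\mathbf{n}))$, whose facets are identified with $\mathcal{D}_n$.
   Context: $\mathcal{D}_n$ is the set of Dyck paths $w=a_1\cdots a_{2n}$ (words in $v,h$, $n$ of each, every prefix having at least as many $v$'s as $h$'s), viewed as lattice paths from $(0,0)$ to $(n,n)$ with $v=(0,1)$, $h=(1,0)$. The lattice $J(\mathbf{2}\times\mathbf{n})$ of order ideals of the product of chains $\{1<2\}\times\{1<\dots<n\}$ is isomorphic to the set of lattice points $\{(x,y):0\le x\le y\le n\}$ with componentwise order; its order complex $\Delta(J(\mathbf{2}\times\mathbf{n}))$ is the simplicial complex of all chains. Its facets (maximal chains) are exactly the sets of $2n+1$ lattice points visited by Dyck paths, and a Dyck path is identified with the facet consisting of the points $a_1+\dots+a_i$, $0\le i\le 2n$. For $1\le i\le 2n-2$, $s_i(w)$ replaces $a_ia_{i+1}a_{i+2}$ by $vhv$ if it equals $vvh$, by $hvh$ if it equals $hhv$, and leaves $w$ unchanged otherwise. $u<_{\Omega_n}w$ iff $u\ne w$ and $u=\sigma_1\cdots\sigma_k(w)$ for some $k\ge1$ and $\sigma_j\in\{s_1,\dots,s_{2n-2}\}$; this is a partial order on $\mathcal{D}_n$. For a partial order $\Omega$ on the facets of a pure simplicial complex, $r_\Omega(F)=\{x\in F:\exists\text{ facet }E<_\Omega F\text{ with }E\cap F=F\setminus\{x\}\}$, and $\Omega$ is a pre-shelling if for all facets $F,G$, $r_\Omega(F)\subseteq G$ and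 $r_\Omega(G)\subseteq F$ imply $F=G$ (equivalently: whenever $F\not\ge_\Omega G$ there are $x\in G$ and a facet $E<_\Omega G$ with $F\cap G\subseteq E\cap G=G\setminus\{x\}$). *)

theory Defs
  imports Main "HOL-Library.Product_Order" "HOL-Library.Product_Plus"
begin

section \<open>Simplicial complexes and pre-shellings\<close>

definition simplicial_complex :: "'a set set \<Rightarrow> bool" where
  "simplicial_complex K \<longleftrightarrow> (\<forall>S\<in>K. finite S \<and> (\<forall>T. T \<subseteq> S \<longrightarrow> T \<in> K))"

definition facets :: "'a set set \<Rightarrow> 'a set set" where
  "facets K = {F \<in> K. \<forall>G\<in>K. F \<subseteq> G \<longrightarrow> G = F}"

definition pure_complex :: "'a set set \<Rightarrow> bool" where
  "pure_complex K \<longleftrightarrow> simplicial_complex K \<and> (\<forall>F\<in>facets K. \<forall>G\<in>facets K. card F = card G)"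

definition restriction :: "'a set set \<Rightarrow> ('a set \<Rightarrow> 'a set \<Rightarrow> bool) \<Rightarrow> 'a set \<Rightarrow> 'a set" where
  "restriction K lt F = {x \<in> F. \<exists>E \<in> facets K. lt E F \<and> E \<inter> F = F - {x}}"

text \<open>The partial order on the facets is given by its strict part \<open>lt\<close>.\<close>

definition pre_shelling :: "'a set set \<Rightarrow> ('a set \<Rightarrow> 'a set \<Rightarrow> bool) \<Rightarrow> bool" where
  "pre_shelling K lt \<longleftrightarrow>
     pure_complex K \<and>
     irreflp_on (facets K) lt \<and> transp_on (facets K) lt \<and>
     (\<forall>F \<in> facets K. \<forall>G \<in> facets K.
        restriction K lt F \<subseteq> G \<and> restriction K lt G \<subseteq> F \<longrightarrow> F = G)"

section \<open>The order complex of the lattice of order ideals\<close>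

definition order_ideals :: "'a::order set \<Rightarrow> 'a set set" where
  "order_ideals P = {I. I \<subseteq> P \<and> (\<forall>x\<in>I. \<forall>y\<in>P. y \<le> x \<longrightarrow> y \<in> I)}"

definition order_complex :: "'a::order set \<Rightarrow> 'a set set" where
  "order_complex P = {C. finite C \<and> C \<subseteq> P \<and> Complete_Partial_Order.chain (\<le>) C}"

text \<open>The order on pairs is componentwise, and the order on ideals is inclusion.\<close>

definition J2n :: "nat \<Rightarrow> (nat \<times> nat) set set" where
  "J2n n = order_ideals ({1, 2} \<times> {1..n})"

section \<open>Dyck paths\<close>

datatype step = V | H

definition dyck_paths :: "nat \<Rightarrow> step list set" where
  "dyck_paths n = {w. count_list w V = n \<and> count_list w H = n \<and>
     (\<forall>i \<le> length w. count_list (take i w) H \<le> count_list (take i w) V)}"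

fun step_vec :: "step \<Rightarrow> nat \<times> nat" where
  "step_vec V = (0, 1)"
| "step_vec H = (1, 0)"

definition visited :: "step list \<Rightarrow> (nat \<times> nat) set" where
  "visited w = {sum_list (map step_vec (take i w)) |i. i \<le> length w}"

text \<open>
  The isomorphism from \<open>{(x, y). 0 \<le> x \<le> y \<le> n}\<close> onto \<open>J2n n\<close>: an order ideal of
  \<open>{1, 2} \<times> {1..n}\<close> has \<open>y\<close> elements in the row of \<open>1\<close> and \<open>x \<le> y\<close> in the row of \<open>2\<close>.
\<close>

fun ideal_of_point :: "nat \<times> nat \<Rightarrow> (nat \<times> nat) set" where
  "ideal_of_point (x, y) = {1} \<times> {1..y} \<union> {2} \<times> {1..x}"

definition dyck_facet :: "step list \<Rightarrow> (nat \<times> nat) set set" where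
  "dyck_facet w = ideal_of_point ` visited w"

section \<open>The partial order\<close>

text \<open>The letter \<open>a\<^sub>i\<close> of \<open>w\<close> is \<open>w ! (i - 1)\<close>; \<open>s_op i\<close> is only used for \<open>1 \<le> i \<le> length w - 2\<close>.\<close>

definition s_op :: "nat \<Rightarrow> step list \<Rightarrow> step list" where
  "s_op i w =
     (if (w ! (i - 1), w ! i, w ! (i + 1)) = (V, V, H) then w[i - 1 := V, i := H, i + 1 := V]
      else if (w ! (i - 1), w ! i, w ! (i + 1)) = (H, H, V) then w[i - 1 := H, i := V, i + 1 := H]
      else w)"

text \<open>\<open>foldr s_op [i\<^sub>1, \<dots>, i\<^sub>k] w\<close> is \<open>s_op i\<^sub>1 (\<dots> (s_op i\<^sub>k w))\<close>.\<close>

definition Omega_less :: "nat \<Rightarrow> step list \<Rightarrow> step list \<Rightarrow> bool" where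
  "Omega_less n u w \<longleftrightarrow> u \<in> dyck_paths n \<and> w \<in> dyck_paths n \<and> u \<noteq> w \<and>
     (\<exists>is. is \<noteq> [] \<and> set is \<subseteq> {1..2 * n - 2} \<and> u = foldr s_op is w)"

definition Omega_facet_less :: "nat \<Rightarrow> (nat \<times> nat) set set \<Rightarrow> (nat \<times> nat) set set \<Rightarrow> bool" where
  "Omega_facet_less n E F \<longleftrightarrow>
     (\<exists>u w. Omega_less n u w \<and> E = dyck_facet u \<and> F = dyck_facet w)"

end

(* Every chain of lattice points 0 <= x <= y <= n extends to a Dyck path, built backwards from its
   last point, and a point of a path is located by its rank x + y; hence the facets are the Dyck
   paths.  The operators s_i replace a factor aab by aba.  Weight every change of letter in a word,
   from a to the next letter, by the number of letters after this a: each nontrivial s_i increases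
   the total weight, so the relation is acyclic.  It also moves exactly one point, the corner
   between a and b in aab, so all such corners belong to the restriction of the path.  Given two
   different Dyck paths, let c be the last letter of their longest common prefix (nonempty, since
   both start with V).  The path that continues with c eventually turns, at a corner of type aab
   which the other path misses. *)
theory Submission
  imports Defs
begin

section \<open>Points of a path\<close>

definition endpoint :: "step list \<Rightarrow> nat \<times> nat" where
  "endpoint w = (count_list w H, count_list w V)"

lemma sum_list_step_vec: "sum_list (map step_vec w) = endpoint w"
proof (induction w)
  case (Cons a w)
  then show ?case by (cases a) (auto simp: endpoint_def)
qed (simp add: endpoint_def zero_prod_def)

lemma visited_eq: "visited w = (\<lambda>i. endpoint (take i w)) ` {..length w}"
  by (auto simp: visited_def sum_list_step_vec)

lemma count_list_H_V: "count_list w H + count_list w V = length w"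
proof (induction w)
  case (Cons a w)
  then show ?case by (cases a) auto
qed simp

text \<open>The coordinates of an endpoint add up to the number of steps, so a point determines its
  position on any path through it.\<close>

lemma endpoint_eqD: "endpoint u = endpoint w \<Longrightarrow> length u = length w"
  by (metis count_list_H_V endpoint_def prod.inject)

lemma endpoint_take_eqD:
  assumes "endpoint (take i u) = endpoint (take j w)" "i \<le> length u" "j \<le> length w"
  shows "i = j"
  using endpoint_eqD[OF assms(1)] assms(2,3) by simp

text \<open>By rank, the only point of \<open>w\<close> that can equal the \<open>i\<close>-th point
  of \<open>u\<close> is its own \<open>i\<close>-th point.\<close>

lemma endpoint_take_in_visited:
  assumes "i \<le> length u" "length u = length w"
  shows "endpoint (take i u) \<in> visited w \<longleftrightarrow> endpoint (take i u) = endpoint (take i w)"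
proof
  assume "endpoint (take i u) \<in> visited w"
  then obtain j where "j \<le> length w" "endpoint (take i u) = endpoint (take j w)"
    by (auto simp: visited_eq)
  then show "endpoint (take i u) = endpoint (take i w)"
    using endpoint_take_eqD assms(1) by metis
qed (use assms in \<open>auto simp: visited_eq\<close>)

lemma endpoint_take_mono: "i \<le> j \<Longrightarrow> endpoint (take i w) \<le> endpoint (take j w)"
proof -
  assume "i \<le> j"
  then have "take j w = take i w @ take (j - i) (drop i w)"
    by (metis le_add_diff_inverse take_add)
  then show ?thesis by (simp add: endpoint_def)
qed

lemma visited_append: "visited u \<subseteq> visited (u @ w)"
proof
  fix x assume "x \<in> visited u"
  then obtain i where "i \<le> length u" "x = endpoint (take i (u @ w))"
    by (auto simp: visited_eq)
  then show "x \<in> visited (u @ w)"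
    unfolding visited_eq by (intro image_eqI[where x = i]) auto
qed

lemma endpoint_in_visited: "endpoint w \<in> visited w"
  by (auto simp: visited_eq intro!: image_eqI[where x = "length w"])

lemma finite_visited: "finite (visited w)"
  by (simp add: visited_eq)

lemma card_visited: "card (visited w) = Suc (length w)"
proof -
  have "inj_on (\<lambda>i. endpoint (take i w)) {..length w}"
    by (rule inj_onI) (auto dest: endpoint_take_eqD)
  then show ?thesis by (simp add: visited_eq card_image)
qed

lemma visited_subset_imp_eq:
  assumes "length u = length w" "visited u \<subseteq> visited w"
  shows "u = w"
proof (rule ccontr)
  assume "u \<noteq> w"
  from same_length_different[OF this assms(1)]
  obtain p a r b r' where d: "a \<noteq> b" "u = p @ [a] @ r" "w = p @ [b] @ r'" by blast
  \<comment> \<open>The point just after the first difference: its rank forces it to be the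
    corresponding point of \<open>w\<close>, yet the last steps differ.\<close>
  have "endpoint (take (Suc (length p)) u) \<in> visited w"
    using d(2) by (intro subsetD[OF assms(2)]) (simp add: visited_eq del: take_append)
  then have "endpoint (p @ [a]) = endpoint (p @ [b])"
    using endpoint_take_in_visited[of "Suc (length p)" u w] assms(1) d by simp
  then show False using d(1) by (cases a; cases b) (auto simp: endpoint_def)
qed

section \<open>Facets of the order complex\<close>

definition points :: "nat \<Rightarrow> (nat \<times> nat) set" where
  "points n = {(x, y). x \<le> y \<and> y \<le> n}"

text \<open>Each coordinate is read off from the largest element of its row; a zero coordinate gives
  an empty row and a trivial inequality.\<close>

lemma ideal_of_point_le_iff: "ideal_of_point p \<subseteq> ideal_of_point q \<longleftrightarrow> p \<le> q"
proof
  assume sub: "ideal_of_point p \<subseteq> ideal_of_point q"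
  obtain x y x' y' where [simp]: "p = (x, y)" "q = (x', y')" by fastforce
  have "y \<le> y'"
  proof (cases "y = 0")
    case False
    then have "(1, y) \<in> ideal_of_point p" by simp
    with sub have "(1, y) \<in> ideal_of_point q" by blast
    then show ?thesis by simp
  qed simp
  moreover have "x \<le> x'"
  proof (cases "x = 0")
    case False
    then have "(2, x) \<in> ideal_of_point p" by simp
    with sub have "(2, x) \<in> ideal_of_point q" by blast
    then show ?thesis by simp
  qed simp
  ultimately show "p \<le> q" by simp
next
  assume "p \<le> q"
  then show "ideal_of_point p \<subseteq> ideal_of_point q"
    by (cases p; cases q) auto
qed

lemma inj_ideal_of_point: "inj ideal_of_point"
  by (rule injI) (metis antisym ideal_of_point_le_iff order_refl)

text \<open>Serves to recognise each of the two rows of an order ideal as an initial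
  segment.\<close>

lemma down_closed_nat:
  fixes S :: "nat set"
  assumes "S \<subseteq> {1..n}" "\<And>i j. i \<in> S \<Longrightarrow> 1 \<le> j \<Longrightarrow> j \<le> i \<Longrightarrow> j \<in> S"
  shows "\<exists>m\<le>n. S = {1..m}"
proof (cases "S = {}")
  case False
  have fin: "finite S" using assms(1) finite_subset by blast
  have "Max S \<in> S" using fin False by simp
  then have "S = {1..Max S}" using assms fin by (auto intro: Max_ge)
  then show ?thesis using \<open>Max S \<in> S\<close> assms(1) by (intro exI[of _ "Max S"]) auto
qed (auto intro!: exI[of _ 0])

lemma J2n_eq: "J2n n = ideal_of_point ` points n"
proof
  show "ideal_of_point ` points n \<subseteq> J2n n"
    by (auto simp: J2n_def order_ideals_def points_def)
next
  show "J2n n \<subseteq> ideal_of_point ` points n"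
  proof
    fix I assume "I \<in> J2n n"
    then have sub: "I \<subseteq> {1, 2} \<times> {1..n}"
      and down: "\<And>x y. x \<in> I \<Longrightarrow> y \<in> {1, 2} \<times> {1..n} \<Longrightarrow> y \<le> x \<Longrightarrow> y \<in> I"
      by (auto simp: J2n_def order_ideals_def)
    have "\<exists>y\<le>n. {j. (1, j) \<in> I} = {1..y}"
    proof (rule down_closed_nat)
      fix i j assume "i \<in> {j. (1, j) \<in> I}" "1 \<le> j" "j \<le> i"
      then show "j \<in> {j. (1, j) \<in> I}" using down[of "(1, i)" "(1, j)"] sub by auto
    qed (use sub in auto)
    then obtain y where y: "y \<le> n" "{j. (1, j) \<in> I} = {1..y}" by blast
    have "\<exists>x\<le>n. {j. (2, j) \<in> I} = {1..x}"
    proof (rule down_closed_nat)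
      fix i j assume "i \<in> {j. (2, j) \<in> I}" "1 \<le> j" "j \<le> i"
      then show "j \<in> {j. (2, j) \<in> I}" using down[of "(2, i)" "(2, j)"] sub by auto
    qed (use sub in auto)
    then obtain x where x: "x \<le> n" "{j. (2, j) \<in> I} = {1..x}" by blast
    have "x \<le> y"
    proof (cases "x = 0")
      case False
      then have "(2, x) \<in> I" using x(2) by auto
      \<comment> \<open>Down-closure across the rows: the upper row cannot be longer than the lower
        one.\<close>
      then have "(1, x) \<in> I" using down[of "(2, x)" "(1, x)"] sub by auto
      then show ?thesis using y(2) by auto
    qed simp
    moreover have "I = ideal_of_point (x, y)"
    proof -
      have "(a, j) \<in> I \<longleftrightarrow> (a, j) \<in> ideal_of_point (x, y)" for a j
        using sub x(2) y(2) by (cases "a = 1"; cases "a = 2") auto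
      then show ?thesis by auto
    qed
    moreover have "(x, y) \<in> points n" using \<open>x \<le> y\<close> y(1) by (simp add: points_def)
    ultimately show "I \<in> ideal_of_point ` points n" by blast
  qed
qed

lemma ideal_image_in_order_complex_iff:
  "ideal_of_point ` D \<in> order_complex (J2n n) \<longleftrightarrow>
     finite D \<and> D \<subseteq> points n \<and> (\<forall>p\<in>D. \<forall>q\<in>D. p \<le> q \<or> q \<le> p)"
  using inj_ideal_of_point
  by (auto simp: order_complex_def J2n_eq chain_def ideal_of_point_le_iff inj_image_subset_iff
      finite_image_iff inj_on_subset)

lemma order_complex_J2n_E:
  assumes "C \<in> order_complex (J2n n)"
  obtains D where "C = ideal_of_point ` D" "finite D" "D \<subseteq> points n"
    "\<forall>p\<in>D. \<forall>q\<in>D. p \<le> q \<or> q \<le> p"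
proof -
  have "C \<subseteq> ideal_of_point ` points n" using assms by (simp add: order_complex_def J2n_eq)
  then obtain D where "C = ideal_of_point ` D" by (auto simp: subset_image_iff)
  then show ?thesis using that assms ideal_image_in_order_complex_iff by metis
qed

section \<open>Dyck paths as maximal chains\<close>

lemma dyck_pathsD:
  assumes "w \<in> dyck_paths n"
  shows "endpoint w = (n, n)" "length w = 2 * n"
    "\<And>i. count_list (take i w) H \<le> count_list (take i w) V"
proof -
  show "endpoint w = (n, n)" using assms by (simp add: dyck_paths_def endpoint_def)
  show "length w = 2 * n" using assms count_list_H_V[of w] by (simp add: dyck_paths_def)
  show "count_list (take i w) H \<le> count_list (take i w) V" for i
    using assms by (cases "i \<le> length w") (auto simp: dyck_paths_def)
qed

lemma visited_dyck_path_chain: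
  assumes "w \<in> dyck_paths n"
  shows "dyck_facet w \<in> order_complex (J2n n)"
  unfolding dyck_facet_def ideal_image_in_order_complex_iff
proof (intro conjI ballI)
  show "finite (visited w)" by (rule finite_visited)
  show "visited w \<subseteq> points n"
  proof
    fix p assume "p \<in> visited w"
    then obtain i where i: "i \<le> length w" "p = endpoint (take i w)" by (auto simp: visited_eq)
    then have "p \<le> (n, n)"
      using endpoint_take_mono[OF i(1), of w] dyck_pathsD(1)[OF assms] by simp
    then show "p \<in> points n"
      using i dyck_pathsD(3)[OF assms, of i] by (auto simp: points_def endpoint_def)
  qed
  fix p q assume "p \<in> visited w" "q \<in> visited w"
  then show "p \<le> q \<or> q \<le> p"
    by (auto simp: visited_eq) (metis endpoint_take_mono linear)
qed

text \<open>At least one last step into \<open>(x, y)\<close> is possible: on the diagonal it is \<open>H\<close>; elsewhere \<open>V\<close>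
  and \<open>H\<close> cannot both fail, as another point of \<open>D\<close> in the row of \<open>(x, y)\<close> and one in its column
  would be incomparable.\<close>

lemma chain_subset_visited:
  assumes "D \<subseteq> {p. fst p \<le> snd p}" "\<forall>p\<in>D. p \<le> (x, y)" "x \<le> y"
    "\<And>p q. p \<in> D \<Longrightarrow> q \<in> D \<Longrightarrow> p \<le> q \<or> q \<le> p"
  shows "\<exists>w. endpoint w = (x, y) \<and> D \<subseteq> visited w \<and>
           (\<forall>i. count_list (take i w) H \<le> count_list (take i w) V)"
  using assms
proof (induction "x + y" arbitrary: x y D rule: less_induct)
  case less
  \<comment> \<open>The end point is supplied by the last step; only the other points must lie on
    the shorter path.\<close>
  define D' where "D' = D - {(x, y)}"
  have D': "D' \<subseteq> {p. fst p \<le> snd p}" "\<And>p q. p \<in> D' \<Longrightarrow> q \<in> D' \<Longrightarrow> p \<le> q \<or> q \<le> p"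
    using less.prems(1,4) by (auto simp: D'_def)
  have extend: ?case
    if w: "endpoint w = (x', y')" "D' \<subseteq> visited w"
      "\<forall>i. count_list (take i w) H \<le> count_list (take i w) V"
      and a: "endpoint (w @ [a]) = (x, y)" for w a x' y'
  proof (intro exI conjI allI)
    show "D \<subseteq> visited (w @ [a])"
      using w(2) visited_append[of w "[a]"] endpoint_in_visited[of "w @ [a]"] a
      by (auto simp: D'_def)
    show "count_list (take i (w @ [a])) H \<le> count_list (take i (w @ [a])) V" for i
    proof (cases "i \<le> length w")
      case False
      then have "take i (w @ [a]) = w @ [a]" by simp
      then show ?thesis using a less.prems(3) by (simp add: endpoint_def)
    qed (use w(3) in simp)
  qed (rule a)
  \<comment> \<open>Either the path is empty, or the last step can be \<open>V\<close>, or it can be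
    \<open>H\<close>.\<close>
  consider "x = 0" "y = 0" | "x < y" "\<forall>p\<in>D'. p \<le> (x, y - 1)"
    | "x > 0" "\<forall>p\<in>D'. p \<le> (x - 1, y)"
  proof (cases "x < y \<and> (\<forall>p\<in>D'. p \<le> (x, y - 1))")
    case False
    have "p \<le> (x - 1, y) \<and> x > 0" if "p \<in> D'" "x + y > 0" for p
    proof -
      obtain a b where p: "p = (a, b)" by fastforce
      have ab: "a \<le> x" "b \<le> y" "a \<le> b" "(a, b) \<noteq> (x, y)"
        using that(1) less.prems(1,2) by (auto simp: D'_def p)
      have "a < x"
      proof (cases "x < y")
        case True
        then obtain c d where "(c, d) \<in> D'" "\<not> (c, d) \<le> (x, y - 1)" using False by auto
        moreover from this have cd: "c \<le> x" "d \<le> y" "(c, d) \<noteq> (x, y)"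
          using less.prems(2) by (auto simp: D'_def)
        ultimately have "d = y" "c < x" by auto
        then show ?thesis
          using D'(2)[OF that(1) \<open>(c, d) \<in> D'\<close>] ab by (auto simp: p)
      next
        \<comment> \<open>Here \<open>x = y\<close>, so \<open>a = x\<close> would force
          \<open>b = y\<close>, the point removed from \<open>D\<close>.\<close>
        case False
        then show ?thesis using ab less.prems(3) by auto
      qed
      then show ?thesis using ab by (simp add: p)
    qed
    \<comment> \<open>With \<open>D'\<close> empty no point yields \<open>x > 0\<close>; the failed
      case condition then gives \<open>x = y\<close>.\<close>
    moreover have "x > 0" if "x + y > 0" "D' = {}"
      using that False less.prems(3) by auto
    ultimately show ?thesis using that by (cases "x + y = 0") blast+
  qed (use that in blast)
  then show ?case
  proof cases
    case 1
    then have "endpoint [] = (x, y)" by (simp add: endpoint_def)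
    moreover have "D \<subseteq> {(0, 0)}" using less.prems(2) 1 by auto
    ultimately show ?thesis
      using 1 by (intro exI[of _ "[]"]) (auto simp: visited_eq)
  next
    case 2
    have "x + (y - 1) < x + y" "x \<le> y - 1" using 2(1) by auto
    then obtain w where "endpoint w = (x, y - 1)" "D' \<subseteq> visited w"
      "\<forall>i. count_list (take i w) H \<le> count_list (take i w) V"
      using less.hyps[OF _ D'(1) 2(2) _ D'(2)] by blast
    then show ?thesis using extend[of w x "y - 1" V] 2 by (simp add: endpoint_def)
  next
    case 3
    have "x - 1 + y < x + y" "x - 1 \<le> y" using 3(1) less.prems(3) by auto
    then obtain w where "endpoint w = (x - 1, y)" "D' \<subseteq> visited w"
      "\<forall>i. count_list (take i w) H \<le> count_list (take i w) V"
      using less.hyps[OF _ D'(1) 3(2) _ D'(2)] by blast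
    then show ?thesis using extend[of w "x - 1" y H] 3 by (simp add: endpoint_def)
  qed
qed

lemma order_complex_subset_dyck_facet:
  assumes "C \<in> order_complex (J2n n)"
  shows "\<exists>w\<in>dyck_paths n. C \<subseteq> dyck_facet w"
proof -
  obtain D where D: "C = ideal_of_point ` D" "finite D" "D \<subseteq> points n"
    "\<forall>p\<in>D. \<forall>q\<in>D. p \<le> q \<or> q \<le> p"
    using assms by (blast elim: order_complex_J2n_E)
  have "\<exists>w. endpoint w = (n, n) \<and> D \<subseteq> visited w \<and>
           (\<forall>i. count_list (take i w) H \<le> count_list (take i w) V)"
  proof (rule chain_subset_visited)
    show "p \<le> q \<or> q \<le> p" if "p \<in> D" "q \<in> D" for p q using D(4) that by blast
  qed (use D(3) in \<open>auto simp: points_def\<close>)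
  then obtain w where "endpoint w = (n, n)" "D \<subseteq> visited w"
    "\<forall>i. count_list (take i w) H \<le> count_list (take i w) V" by blast
  then show ?thesis
    by (intro bexI[of _ w]) (auto simp: D(1) dyck_facet_def dyck_paths_def endpoint_def)
qed

lemma dyck_facet_subset_imp_eq:
  assumes "u \<in> dyck_paths n" "w \<in> dyck_paths n" "dyck_facet u \<subseteq> dyck_facet w"
  shows "u = w"
  using assms dyck_pathsD(2) inj_ideal_of_point
  by (intro visited_subset_imp_eq) (auto simp: dyck_facet_def inj_image_subset_iff)

text \<open>A chain containing \<open>dyck_facet w\<close> lies in the facet of some Dyck path;
  inclusion between two such facets is equality, which squeezes the chain.\<close>

lemma dyck_facet_in_facets:
  assumes "w \<in> dyck_paths n"
  shows "dyck_facet w \<in> facets (order_complex (J2n n))"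
proof -
  have "C = dyck_facet w" if "C \<in> order_complex (J2n n)" "dyck_facet w \<subseteq> C" for C
    using order_complex_subset_dyck_facet[OF that(1)] that(2) dyck_facet_subset_imp_eq[OF assms]
    by blast
  then show ?thesis using visited_dyck_path_chain[OF assms] by (auto simp: facets_def)
qed

lemma facets_order_complex_J2n: "facets (order_complex (J2n n)) = dyck_facet ` dyck_paths n"
proof
  show "facets (order_complex (J2n n)) \<subseteq> dyck_facet ` dyck_paths n"
  proof
    fix F assume F: "F \<in> facets (order_complex (J2n n))"
    then have "F \<in> order_complex (J2n n)" by (simp add: facets_def)
    then obtain w where w: "w \<in> dyck_paths n" "F \<subseteq> dyck_facet w"
      using order_complex_subset_dyck_facet by blast
    then have "dyck_facet w = F"
      using F visited_dyck_path_chain[OF w(1)] by (auto simp: facets_def)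
    then show "F \<in> dyck_facet ` dyck_paths n" using w(1) by blast
  qed
qed (auto intro: dyck_facet_in_facets)

lemma inj_on_dyck_facet: "inj_on dyck_facet (dyck_paths n)"
  by (rule inj_onI) (simp add: dyck_facet_subset_imp_eq)

lemma card_dyck_facet: "card (dyck_facet w) = Suc (length w)"
  unfolding dyck_facet_def
  using card_image[OF inj_on_subset[OF inj_ideal_of_point subset_UNIV]] card_visited by metis

lemma pure_order_complex_J2n: "pure_complex (order_complex (J2n n))"
proof -
  have "simplicial_complex (order_complex (J2n n))"
    by (auto simp: simplicial_complex_def order_complex_def chain_def intro: finite_subset)
  moreover have "card F = 2 * n + 1" if "F \<in> facets (order_complex (J2n n))" for F
    using that by (auto simp: facets_order_complex_J2n card_dyck_facet dyck_pathsD(2))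
  ultimately show ?thesis by (simp add: pure_complex_def)
qed

section \<open>The partial order\<close>

text \<open>With only two letters, both rewriting rules become \<open>aac\<close> to
  \<open>aca\<close> for \<open>a \<noteq> c\<close>. The index is \<open>Suc (length p)\<close>
  because \<open>s_op\<close> counts letters from 1.\<close>

lemma s_op_append:
  "s_op (Suc (length p)) (p @ a # b # c # q) =
     (if a = b \<and> b \<noteq> c then p @ a # c # a # q else p @ a # b # c # q)"
  by (cases a; cases b; cases c) (auto simp: s_op_def nth_append list_update_append)

lemma s_op_cases:
  assumes "i \<in> {1..2 * n - 2}" "length w = 2 * n"
  obtains "s_op i w = w"
    | p a c q where "a \<noteq> c" "w = p @ a # a # c # q" "s_op i w = p @ a # c # a # q"
proof -
  define p where "p = take (i - 1) w"
  have "i - 1 \<le> length w" using assms by auto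
  then have "length p = i - 1" by (simp add: p_def)
  moreover obtain a b c q where "drop (i - 1) w = a # b # c # q"
  proof -
    have "3 \<le> length (drop (i - 1) w)" using assms by auto
    then show ?thesis
      using that by (auto simp: numeral_3_eq_3 Suc_le_length_iff simp del: length_drop)
  qed
  ultimately have "w = p @ a # b # c # q" "i = Suc (length p)"
    using assms append_take_drop_id[of "i - 1" w] by (auto simp: p_def)
  then show ?thesis using that s_op_append[of p a b c q] by metis
qed

fun change_weight :: "step list \<Rightarrow> nat" where
  "change_weight (a # b # w) = (if a \<noteq> b then Suc (length w) else 0) + change_weight (b # w)"
| "change_weight _ = 0"

lemma change_weight_swap:
  assumes "a \<noteq> c"
  shows "change_weight (p @ a # a # c # q) < change_weight (p @ a # c # a # q)"
proof (induction p)
  case Nil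
  \<comment> \<open>Replacing the first letter affects only the first possible change, whose weight
    is \<open>length q\<close>.\<close>
  have "change_weight (c # q) \<le> change_weight (a # q) + length q" by (cases q) auto
  then show ?case using assms by simp
next
  case (Cons b p)
  \<comment> \<open>Both words have the same length and, after \<open>b\<close>, the same next
    letter, so \<open>b\<close> contributes equally to both weights.\<close>
  then show ?case by (cases p) auto
qed

text \<open>Only the length is carried through the induction, since \<open>s_op_cases\<close> asks
  for nothing more of the intermediate words.\<close>

lemma change_weight_foldr_s_op:
  assumes "set is \<subseteq> {1..2 * n - 2}" "length w = 2 * n"
  shows "length (foldr s_op is w) = 2 * n \<and>
    (foldr s_op is w = w \<or> change_weight w < change_weight (foldr s_op is w))"
  using assms
proof (induction "is")
  case (Cons i "is")
  define u where "u = foldr s_op is w"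
  have u: "length u = 2 * n" "u = w \<or> change_weight w < change_weight u"
    using Cons by (auto simp: u_def)
  have "i \<in> {1..2 * n - 2}" using Cons.prems by simp
  then have "length (s_op i u) = 2 * n \<and> (s_op i u = w \<or> change_weight w < change_weight (s_op i u))"
    using u(1)
  proof (cases rule: s_op_cases)
    case (2 p a c q)
    then show ?thesis using u change_weight_swap[OF 2(1), of p q] by auto
  qed (use u in auto)
  then show ?case by (simp add: u_def)
qed simp

lemma Omega_less_change_weight:
  assumes "Omega_less n u w"
  shows "change_weight w < change_weight u"
  using assms change_weight_foldr_s_op dyck_pathsD(2) unfolding Omega_less_def by blast

lemma Omega_less_trans:
  assumes "Omega_less n u v" "Omega_less n v w"
  shows "Omega_less n u w"
proof -
  \<comment> \<open>The weight strictly increases twice from \<open>w\<close> to \<open>u\<close>,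
    which rules out a cycle.\<close>
  have "u \<noteq> w"
    using assms[THEN Omega_less_change_weight] by auto
  moreover obtain "is" js where "u = foldr s_op is v" "v = foldr s_op js w"
    "is \<noteq> []" "set is \<subseteq> {1..2 * n - 2}" "set js \<subseteq> {1..2 * n - 2}"
    using assms by (auto simp: Omega_less_def)
  then have "u = foldr s_op (is @ js) w \<and> is @ js \<noteq> [] \<and> set (is @ js) \<subseteq> {1..2 * n - 2}"
    by simp
  ultimately show ?thesis using assms unfolding Omega_less_def by blast
qed

section \<open>Restriction sets\<close>

text \<open>Prefixes ending before the exchanged letters coincide, and those containing both have
  the same letter counts.\<close>

lemma endpoint_take_swap:
  assumes "i \<noteq> length p + 2"
  shows "endpoint (take i (p @ a # c # a # q)) = endpoint (take i (p @ a # a # c # q))"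
proof (cases "i \<le> length p + 1")
  case True
  \<comment> \<open>Truncated subtraction: the value 0 covers every
    \<open>i \<le> length p\<close>.\<close>
  then have "i - length p = 0 \<or> i - length p = 1" by auto
  then show ?thesis by auto
next
  case False
  then have "length p + 3 \<le> i" using assms by simp
  then obtain k where "i = length p + 3 + k" using le_Suc_ex by blast
  then show ?thesis by (simp add: endpoint_def numeral_3_eq_3)
qed

text \<open>Only the point after \<open>p @ [a, c]\<close> is new; there \<open>a\<close> and
  \<open>c\<close> balance, so the prefix condition is inherited from \<open>p\<close>.\<close>

lemma swap_dyck_path:
  assumes "p @ a # a # c # q \<in> dyck_paths n" "a \<noteq> c"
  shows "p @ a # c # a # q \<in> dyck_paths n"
proof -
  have "count_list (take i (p @ a # c # a # q)) H \<le> count_list (take i (p @ a # c # a # q)) V" for i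
  proof (cases "i = length p + 2")
    case True
    have "count_list p H \<le> count_list p V"
      using dyck_pathsD(3)[OF assms(1), of "length p"] by simp
    then show ?thesis using True assms(2) by (cases a; cases c) auto
  next
    case False
    then show ?thesis
      using endpoint_take_swap[OF False, of a c q] dyck_pathsD(3)[OF assms(1), of i]
      by (simp add: endpoint_def)
  qed
  moreover have "endpoint (p @ a # c # a # q) = (n, n)"
    using dyck_pathsD(1)[OF assms(1)]
      \<comment> \<open>This index is the full length of both words.\<close>
      endpoint_take_swap[of "length p + length q + 3" p a c q] by simp
  ultimately show ?thesis by (simp add: dyck_paths_def endpoint_def)
qed

text \<open>The path with the last two letters of \<open>aac\<close> exchanged is smaller and shares
  every point of \<open>w\<close> except the corner.\<close>

lemma corner_in_restriction:
  assumes w: "w = p @ a # a # c # q" "w \<in> dyck_paths n" and "a \<noteq> c"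
  shows "ideal_of_point (endpoint (p @ [a, a]))
           \<in> restriction (order_complex (J2n n)) (Omega_facet_less n) (dyck_facet w)"
proof -
  define u where "u = p @ a # c # a # q"
  define x where "x = endpoint (p @ [a, a])"
  have u: "u \<in> dyck_paths n" using swap_dyck_path assms by (simp add: u_def)
  have "u = foldr s_op [Suc (length p)] w"
    using \<open>a \<noteq> c\<close> by (simp add: u_def w(1) s_op_append)
  moreover have "set [Suc (length p)] \<subseteq> {1..2 * n - 2}"
    using dyck_pathsD(2)[OF w(2)] by (simp add: w(1))
  moreover have "u \<noteq> w" using \<open>a \<noteq> c\<close> by (simp add: u_def w(1))
  ultimately have "Omega_less n u w" using u w(2) unfolding Omega_less_def by blast
  then have less: "Omega_facet_less n (dyck_facet u) (dyck_facet w)"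
    by (auto simp: Omega_facet_less_def)
  have x: "x = endpoint (take (length p + 2) w)" by (simp add: x_def w(1))
  have len: "length w = length u" by (simp add: w(1) u_def)
  have "x \<noteq> endpoint (take (length p + 2) u)"
    using \<open>a \<noteq> c\<close> by (cases a; cases c) (auto simp: x_def u_def endpoint_def)
  then have "endpoint (take i w) \<in> visited u \<longleftrightarrow> endpoint (take i w) \<noteq> x"
    if "i \<le> length w" for i
    unfolding endpoint_take_in_visited[OF that len]
    using that endpoint_take_swap[of i p a c q] endpoint_take_eqD[of i w "length p + 2" w] x
    by (cases "i = length p + 2") (auto simp: w(1) u_def)
  then have "visited u \<inter> visited w = visited w - {x}" by (auto simp: visited_eq[of w])
  then have "dyck_facet u \<inter> dyck_facet w = dyck_facet w - {ideal_of_point x}"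
    unfolding dyck_facet_def
    by (metis image_Int image_empty image_insert image_set_diff inj_ideal_of_point)
  moreover have "x \<in> visited w"
    unfolding visited_eq x by (rule imageI) (simp add: w(1))
  then have "ideal_of_point x \<in> dyck_facet w" by (simp add: dyck_facet_def)
  ultimately show ?thesis
    using less dyck_facet_in_facets[OF u] by (auto simp: restriction_def x_def)
qed

lemma restriction_not_subset:
  assumes w: "w = p @ c # c # r" "w \<in> dyck_paths n"
    and u: "u = p @ c # b # r'" "u \<in> dyck_paths n" and "b \<noteq> c"
  shows "\<not> restriction (order_complex (J2n n)) (Omega_facet_less n) (dyck_facet w) \<subseteq> dyck_facet u"
proof
  assume sub: "restriction (order_complex (J2n n)) (Omega_facet_less n) (dyck_facet w) \<subseteq> dyck_facet u"
  \<comment> \<open>Equal letter counts force a \<open>b\<close> into \<open>r\<close>, because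
    \<open>u\<close> has one right after \<open>p @ [c]\<close>. The first such \<open>b\<close>
    ends the run of \<open>c\<close>.\<close>
  have "endpoint w = endpoint u" using dyck_pathsD(1)[OF w(2)] dyck_pathsD(1)[OF u(2)] by simp
  then have "count_list w b = count_list u b" by (cases b) (auto simp: endpoint_def)
  then have "count_list r b \<noteq> 0" using \<open>b \<noteq> c\<close> by (auto simp: w(1) u(1))
  then have "b \<in> set r" using count_notin by metis
  then obtain ys zs where r: "r = ys @ b # zs" "b \<notin> set ys"
    by (auto dest: split_list_first)
  have "z = c" if "z \<in> set ys" for z
  proof -
    have "z \<noteq> b" using that r(2) by blast
    then show ?thesis using \<open>b \<noteq> c\<close> by (cases z; cases b; cases c) auto
  qed
  then have ys: "ys = replicate (length ys) c" by (simp add: replicate_eqI)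
  \<comment> \<open>Regrouping the run of \<open>c\<close> places its last two letters directly
    before \<open>b\<close>, exposing the corner.\<close>
  have "c # c # ys = ys @ [c, c]"
    by (subst (1 2) ys) (simp flip: replicate_append_same)
  then have w': "w = (p @ ys) @ c # c # b # zs" by (simp add: w(1) r(1))
  define x where "x = endpoint ((p @ ys) @ [c, c])"
  have "ideal_of_point x \<in> dyck_facet u"
    using corner_in_restriction[OF w' w(2)] \<open>b \<noteq> c\<close> sub by (auto simp: x_def)
  then have "x \<in> visited u"
    using inj_ideal_of_point by (simp add: dyck_facet_def inj_image_mem_iff)
  moreover have len: "length w = length u" using dyck_pathsD(2) w(2) u(2) by simp
  define m where "m = length p + 2 + length ys"
  have x: "x = endpoint (take m w)" and "m \<le> length w"
    by (auto simp: x_def w' m_def)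
  ultimately have "x = endpoint (take m u)"
    using endpoint_take_in_visited len by blast
  \<comment> \<open>The prefix of \<open>w\<close> has no \<open>b\<close> beyond those of
    \<open>p\<close>, whereas the prefix of \<open>u\<close> of the same length has at least one
    more.\<close>
  then have "count_list ((p @ ys) @ [c, c]) b = count_list (take m u) b"
    by (cases b) (auto simp: x_def endpoint_def)
  moreover have "take m u = p @ c # b # take (length ys) r'" by (simp add: u(1) m_def)
  ultimately show False using \<open>b \<noteq> c\<close> r(2) by simp
qed

text \<open>An initial \<open>H\<close> would violate the condition on the prefix of length
  1.\<close>

lemma dyck_path_hd:
  assumes "a # w \<in> dyck_paths n"
  shows "a = V"
  using dyck_pathsD(3)[OF assms, of 1] by (cases a) auto

lemma restriction_subset_imp_eq:
  assumes "u \<in> dyck_paths n" "w \<in> dyck_paths n"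
    and "restriction (order_complex (J2n n)) (Omega_facet_less n) (dyck_facet u) \<subseteq> dyck_facet w"
    and "restriction (order_complex (J2n n)) (Omega_facet_less n) (dyck_facet w) \<subseteq> dyck_facet u"
  shows "u = w"
proof (rule ccontr)
  assume "u \<noteq> w"
  moreover have "length u = length w" using assms(1,2) dyck_pathsD(2) by simp
  ultimately obtain p a r b r' where d: "a \<noteq> b" "u = p @ [a] @ r" "w = p @ [b] @ r'"
    using same_length_different by blast
  have "p \<noteq> []"
    using d assms(1,2) dyck_path_hd[of a r n] dyck_path_hd[of b r' n] by auto
  then obtain p' c where p: "p = p' @ [c]" by (metis append_butlast_last_id)
  \<comment> \<open>In a two-letter alphabet, exactly one of the two paths repeats \<open>c\<close>
    after the common prefix.\<close>
  consider "c = a" | "c = b" using d(1) by (cases a; cases b; cases c) auto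
  then show False
  proof cases
    case 1
    then show ?thesis
      using restriction_not_subset[of u p' c r n w b r'] assms d p by auto
  next
    case 2
    then show ?thesis
      using restriction_not_subset[of w p' c r' n u a r] assms d p by auto
  qed
qed

theorem theorem3p5:
  fixes n :: nat
  assumes "n \<ge> 1"
  shows "bij_betw dyck_facet (dyck_paths n) (facets (order_complex (J2n n))) \<and>
         pre_shelling (order_complex (J2n n)) (Omega_facet_less n)"
proof
  show "bij_betw dyck_facet (dyck_paths n) (facets (order_complex (J2n n)))"
    by (simp add: bij_betw_def inj_on_dyck_facet facets_order_complex_J2n)
  \<comment> \<open>\<open>Omega_facet_less\<close> only asserts that some representing paths exist.
    Injectivity identifies the two representatives of a facet, for irreflexivity and for the middle
    facet in transitivity.\<close>
  have inj: "u = w" if "dyck_facet u = dyck_facet w" "u \<in> dyck_paths n" "w \<in> dyck_paths n" for u w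
    using inj_onD[OF inj_on_dyck_facet that] .
  have paths: "u \<in> dyck_paths n \<and> w \<in> dyck_paths n \<and> u \<noteq> w" if "Omega_less n u w" for u w
    using that by (simp add: Omega_less_def)
  show "pre_shelling (order_complex (J2n n)) (Omega_facet_less n)"
    unfolding pre_shelling_def
  proof (intro conjI)
    show "pure_complex (order_complex (J2n n))" by (rule pure_order_complex_J2n)
    show "irreflp_on (facets (order_complex (J2n n))) (Omega_facet_less n)"
      unfolding Omega_facet_less_def by (rule irreflp_onI) (metis inj paths)
    show "transp_on (facets (order_complex (J2n n))) (Omega_facet_less n)"
      unfolding Omega_facet_less_def
      by (rule transp_onI) (metis inj paths Omega_less_trans)
    show "\<forall>F\<in>facets (order_complex (J2n n)). \<forall>G\<in>facets (order_complex (J2n n)).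
        restriction (order_complex (J2n n)) (Omega_facet_less n) F \<subseteq> G \<and>
        restriction (order_complex (J2n n)) (Omega_facet_less n) G \<subseteq> F \<longrightarrow> F = G"
      using restriction_subset_imp_eq by (auto simp: facets_order_complex_J2n)
  qed
qed

end
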